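(* Let $H$ and $K$ be complex separable infinite-dimensional Hilbert spaces. Then the closures of $CSO_b(H,K)$ in $B(H,K)$ with respect to the strong-$*$ topology (SST), the strong operator topology (SOT) and the weak operator topology (WOT) all equal $B(H,K)$: $$\overline{CSO_b(H,K)}^{\,SST}=\overline{CSO_b(H,K)}^{\,SOT}=\overline{CSO_b(H,K)}^{\,WOT}=B(H,K).$$
   Context: $B(H,K)$ is the space of all bounded linear operators from $H$ to $K$. The strong-$*$ topology is the one in which $T_i\to T$ iff $T_ix\to Tx$ for all $x\in H$ and $T_i^*y\to T^*y$ for all $y\in K$. A conjugation pair from $H$ to $K$ is a pair $(C_1,C_2)$ of conjugate-linear operators $C_1:H\to K$, $C_2:K\to H$ such that $C_2C_1=\mathrm{id}_H$ or $C_1C_2=\mathrm{id}_K$, and $\langle C_1x,y\rangle_K=\langle C_2y,x\rangle_H$ for all $x\in H$, $y\in K$. An operator $T$ from $H$ to $K$ is $(C_1,C_2)$-symmetric if $C_2T=T^*C_1$ whenever $C_2C_1=\mathrm{id}_H$, and $TC_2=C_1T^*$ whenever $C_1C_2=\mathrm{id}_K$. $T$ is complex symmetric if it is $(C_1,C_2)$-symmetric for some conjugation pair $(C_1,C_2)$ from $H$ to $K$. $CSO_b(H,K)$ denotes the set of all complex symmetric operators in $B(H,K)$. *)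

theory Defs
  imports "HOL-Analysis.Analysis"
begin

section \<open>Complex Hilbert spaces\<close>

text \<open>
  A complex inner product space is presented on top of the real inner product space that
  underlies it, whose inner product is the real part of the complex one. Positive
  definiteness of \<open>cinner\<close>, and the fact that the norm and the topology are the ones it induces,
  are therefore inherited from \<^class>\<open>real_inner\<close>; see \<open>norm_eq_sqrt_cinner\<close> below.
  The inner product is linear in the first and conjugate-linear in the second argument.
\<close>

class complex_inner = real_inner +
  fixes scaleC :: "complex \<Rightarrow> 'a \<Rightarrow> 'a"  (infixr "*\<^sub>C" 75)
    and cinner :: "'a \<Rightarrow> 'a \<Rightarrow> complex"
  assumes scaleC_add_right: "a *\<^sub>C (x + y) = a *\<^sub>C x + a *\<^sub>C y"
    and scaleC_add_left: "(a + b) *\<^sub>C x = a *\<^sub>C x + b *\<^sub>C x"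
    and scaleC_scaleC: "a *\<^sub>C (b *\<^sub>C x) = (a * b) *\<^sub>C x"
    and scaleC_of_real: "complex_of_real r *\<^sub>C x = r *\<^sub>R x"
    and cinner_commute: "cinner x y = cnj (cinner y x)"
    and cinner_add_left: "cinner (x + y) z = cinner x z + cinner y z"
    and cinner_scaleC_left: "cinner (a *\<^sub>C x) y = a * cinner x y"
    and Re_cinner: "Re (cinner x y) = inner x y"

class complex_hilbert = complex_inner + complete_space

lemma scaleC_one: "1 *\<^sub>C x = (x :: 'a::complex_inner)"
  using scaleC_of_real[of 1 x] by simp

global_interpretation complex_vector: vector_space "scaleC :: complex \<Rightarrow> 'a \<Rightarrow> 'a::complex_inner"
  defines cspan = complex_vector.span
  by unfold_locales (simp_all add: scaleC_add_right scaleC_add_left scaleC_scaleC scaleC_one)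

lemma cinner_self: "cinner x x = complex_of_real ((norm (x :: 'a::complex_inner))\<^sup>2)"
proof (rule complex_eqI)
  show "Re (cinner x x) = Re (complex_of_real ((norm x)\<^sup>2))"
    by (simp add: Re_cinner power2_norm_eq_inner)
  have "Im (cinner x x) = - Im (cinner x x)"
    using cinner_commute[of x x] by (metis cnj.simps(2))
  then show "Im (cinner x x) = Im (complex_of_real ((norm x)\<^sup>2))"
    by simp
qed

lemma norm_eq_sqrt_cinner: "norm (x :: 'a::complex_inner) = sqrt (Re (cinner x x))"
  by (simp add: cinner_self)

lemma cinner_eq_zero_iff: "cinner x x = 0 \<longleftrightarrow> x = (0 :: 'a::complex_inner)"
  by (simp add: cinner_self)

instantiation complex :: complex_hilbert
begin

definition scaleC_complex :: "complex \<Rightarrow> complex \<Rightarrow> complex"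
  where "scaleC_complex a x = a * x"

definition cinner_complex :: "complex \<Rightarrow> complex \<Rightarrow> complex"
  where "cinner_complex x y = x * cnj y"

instance
  by intro_classes
    (simp_all add: scaleC_complex_def cinner_complex_def inner_complex_def algebra_simps scaleR_conv_of_real)

end

definition infinite_dimensional :: "'a::complex_inner itself \<Rightarrow> bool"
  where "infinite_dimensional _ \<longleftrightarrow> \<not> (\<exists>B :: 'a set. finite B \<and> cspan B = UNIV)"


section \<open>Bounded operators and their topologies\<close>

definition bounded_operators :: "('h::complex_hilbert \<Rightarrow> 'k::complex_hilbert) set"
  where "bounded_operators = {T. bounded_linear T \<and> (\<forall>a x. T (a *\<^sub>C x) = a *\<^sub>C T x)}"

definition cadjoint :: "('h::complex_hilbert \<Rightarrow> 'k::complex_hilbert) \<Rightarrow> 'k \<Rightarrow> 'h"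
  where "cadjoint T = (THE S. \<forall>x y. cinner (T x) y = cinner x (S y))"

lemma cadjoint_eqI:
  assumes "\<And>x y. cinner (T x) y = cinner x (S y)"
  shows "cadjoint T = S"
  unfolding cadjoint_def
proof (rule the_equality)
  show "\<forall>x y. cinner (T x) y = cinner x (S y)"
    using assms by blast
next
  fix S' assume S': "\<forall>x y. cinner (T x) y = cinner x (S' y)"
  show "S' = S"
  proof
    fix y
    have "inner x (S' y) = inner x (S y)" for x
      using S' assms by (metis Re_cinner)
    then show "S' y = S y"
      using vector_eq_ldot by blast
  qed
qed

text \<open>
  On function types, \<^const>\<open>euclidean\<close> is the topology of pointwise convergence. Each operator
  topology is the initial topology on \<^const>\<open>bounded_operators\<close> for the indicated evaluations;
  the lemmas \<open>limitin_\<dots>\<close> describe convergence along arbitrary filters, hence of arbitrary nets.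
\<close>

definition SOT :: "('h::complex_hilbert \<Rightarrow> 'k::complex_hilbert) topology"
  where "SOT = pullback_topology bounded_operators (\<lambda>T. T) euclidean"

definition WOT :: "('h::complex_hilbert \<Rightarrow> 'k::complex_hilbert) topology"
  where "WOT = pullback_topology bounded_operators (\<lambda>T x y. cinner (T x) y) euclidean"

definition SST :: "('h::complex_hilbert \<Rightarrow> 'k::complex_hilbert) topology"
  where "SST = pullback_topology bounded_operators (\<lambda>T. (T, cadjoint T)) euclidean"

lemma limitin_pullback_euclidean:
  "limitin (pullback_topology A f euclidean) g l F \<longleftrightarrow>
     l \<in> A \<and> (\<forall>\<^sub>F i in F. g i \<in> A) \<and> ((\<lambda>i. f (g i)) \<longlongrightarrow> f l) F" (is "?L \<longleftrightarrow> ?R")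
proof
  assume L: ?L
  have l: "l \<in> A"
    using L by (simp add: limitin_def topspace_pullback_topology)
  have ev: "\<forall>\<^sub>F i in F. g i \<in> f -` U \<inter> A" if "open U" "f l \<in> U" for U
  proof -
    have "openin (pullback_topology A f euclidean) (f -` U \<inter> A)"
      using that by (auto simp: openin_pullback_topology)
    then show ?thesis
      using L l that unfolding limitin_def by blast
  qed
  have "\<forall>\<^sub>F i in F. g i \<in> A"
    using ev[of UNIV] by simp
  moreover have "((\<lambda>i. f (g i)) \<longlongrightarrow> f l) F"
    by (rule topological_tendstoI) (rule eventually_mono[OF ev], auto)
  ultimately show ?R
    using l by simp
next
  assume R: ?R
  then show ?L
    unfolding limitin_def openin_pullback_topology topspace_pullback_topology
    by (auto dest!: topological_tendstoD intro: eventually_conj)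
qed

lemma tendsto_fun_iff:
  "(g \<longlongrightarrow> l) F \<longleftrightarrow> (\<forall>x. ((\<lambda>i. g i x) \<longlongrightarrow> l x) F)"
  for g :: "'i \<Rightarrow> 'a \<Rightarrow> 'b::topological_space"
  using limitin_componentwise[of "\<lambda>_. euclidean :: 'b topology" UNIV g l F]
  by (simp add: euclidean_product_topology)

lemma limitin_SOT:
  "limitin SOT S T F \<longleftrightarrow>
     T \<in> bounded_operators \<and> (\<forall>\<^sub>F i in F. S i \<in> bounded_operators) \<and>
     (\<forall>x. ((\<lambda>i. S i x) \<longlongrightarrow> T x) F)"
  unfolding SOT_def limitin_pullback_euclidean tendsto_fun_iff ..

lemma limitin_WOT:
  "limitin WOT S T F \<longleftrightarrow>
     T \<in> bounded_operators \<and> (\<forall>\<^sub>F i in F. S i \<in> bounded_operators) \<and>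
     (\<forall>x y. ((\<lambda>i. cinner (S i x) y) \<longlongrightarrow> cinner (T x) y) F)"
  unfolding WOT_def limitin_pullback_euclidean tendsto_fun_iff ..

lemma limitin_SST:
  "limitin SST S T F \<longleftrightarrow>
     T \<in> bounded_operators \<and> (\<forall>\<^sub>F i in F. S i \<in> bounded_operators) \<and>
     (\<forall>x. ((\<lambda>i. S i x) \<longlongrightarrow> T x) F) \<and>
     (\<forall>y. ((\<lambda>i. cadjoint (S i) y) \<longlongrightarrow> cadjoint T y) F)"
proof -
  have "((\<lambda>i. (S i, cadjoint (S i))) \<longlongrightarrow> (T, cadjoint T)) F \<longleftrightarrow>
      (S \<longlongrightarrow> T) F \<and> ((\<lambda>i. cadjoint (S i)) \<longlongrightarrow> cadjoint T) F"
    by (auto intro: tendsto_Pair dest: tendsto_fst tendsto_snd)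
  then show ?thesis
    unfolding SST_def limitin_pullback_euclidean by (simp add: tendsto_fun_iff)
qed


section \<open>Complex symmetric operators\<close>

definition conjugate_linear :: "('h::complex_hilbert \<Rightarrow> 'k::complex_hilbert) \<Rightarrow> bool"
  where "conjugate_linear C \<longleftrightarrow>
    (\<forall>x y. C (x + y) = C x + C y) \<and> (\<forall>a x. C (a *\<^sub>C x) = cnj a *\<^sub>C C x)"

definition conjugation_pair ::
    "('h::complex_hilbert \<Rightarrow> 'k::complex_hilbert) \<Rightarrow> ('k \<Rightarrow> 'h) \<Rightarrow> bool"
  where "conjugation_pair C1 C2 \<longleftrightarrow>
    conjugate_linear C1 \<and> conjugate_linear C2 \<and>
    (C2 \<circ> C1 = id \<or> C1 \<circ> C2 = id) \<and>
    (\<forall>x y. cinner (C1 x) y = cinner (C2 y) x)"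

definition pair_symmetric ::
    "('h::complex_hilbert \<Rightarrow> 'k::complex_hilbert) \<Rightarrow> ('k \<Rightarrow> 'h) \<Rightarrow> ('h \<Rightarrow> 'k) \<Rightarrow> bool"
  where "pair_symmetric C1 C2 T \<longleftrightarrow>
    (C2 \<circ> C1 = id \<longrightarrow> C2 \<circ> T = cadjoint T \<circ> C1) \<and>
    (C1 \<circ> C2 = id \<longrightarrow> T \<circ> C2 = C1 \<circ> cadjoint T)"

definition CSO_b :: "('h::complex_hilbert \<Rightarrow> 'k::complex_hilbert) set"
  where "CSO_b = {T \<in> bounded_operators. \<exists>C1 C2. conjugation_pair C1 C2 \<and> pair_symmetric C1 C2 T}"

end

theory Submission
  imports Defs
begin

text \<open>
  If \<open>C\<^sub>2 C\<^sub>1 = id\<close>, then \<open>T + C\<^sub>1 T\<^sup>* C\<^sub>1\<close> is \<open>(C\<^sub>1, C\<^sub>2)\<close>-symmetric for every bounded \<open>T\<close>. Given orthonormal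
  bases \<open>e\<close> of \<open>H\<close> and \<open>f\<close> of \<open>K\<close>, apply this to the truncation of \<open>T\<close> to the first \<open>n\<close> basis vectors
  and to the antilinear isometry \<open>C\<^sub>1\<close> that sends \<open>e\<close> to the sequence obtained from \<open>f\<close> by exchanging
  its blocks \<open>[0, n)\<close> and \<open>[n, 2n)\<close>. The correction \<open>C\<^sub>1 T\<^sup>* C\<^sub>1\<close> then annihilates the first \<open>n\<close> basis
  vectors, so it and its adjoint tend to 0 strongly; hence \<open>T\<close> is the limit of a sequence of complex
  symmetric operators in the strong-* topology, the finest of the three.
\<close>

section \<open>Complex inner products\<close>

lemma cinner_add_right: "cinner x (y + z) = cinner x y + cinner x z"
  for x :: "'a::complex_inner"
  by (metis cinner_commute cinner_add_left complex_cnj_add)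

lemma cinner_scaleC_right: "cinner x (a *\<^sub>C y) = cnj a * cinner x y"
  for x :: "'a::complex_inner"
  by (metis cinner_commute cinner_scaleC_left complex_cnj_mult)

lemma norm_scaleC: "norm (a *\<^sub>C x) = cmod a * norm x"
  for x :: "'a::complex_inner"
proof -
  have "complex_of_real ((norm (a *\<^sub>C x))\<^sup>2) = (a * cnj a) * cinner x x"
    by (simp only: cinner_self[symmetric] cinner_scaleC_left cinner_scaleC_right mult_ac)
  also have "\<dots> = complex_of_real ((cmod a * norm x)\<^sup>2)"
    by (simp only: complex_norm_square[symmetric] cinner_self of_real_mult power_mult_distrib)
  finally have "(norm (a *\<^sub>C x))\<^sup>2 = (cmod a * norm x)\<^sup>2"
    unfolding of_real_eq_iff .
  then show ?thesis
    by (simp add: power2_eq_iff_nonneg)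
qed

text \<open>Reduces to the real Cauchy-Schwarz inequality: multiplying \<open>x\<close> by the
  unimodular \<open>a\<close> replaces \<open>cinner x y\<close> by its modulus, which is then a
  real inner product.\<close>

lemma norm_cinner_le: "cmod (cinner x y) \<le> norm x * norm y"
  for x :: "'a::complex_inner"
proof (cases "cinner x y = 0")
  case False
  define a where "a = cnj (sgn (cinner x y))"
  have a: "cmod a = 1"
    using False by (simp add: a_def norm_sgn)
  have "cinner (a *\<^sub>C x) y = (cinner x y * cnj (cinner x y)) / complex_of_real (cmod (cinner x y))"
    by (simp add: cinner_scaleC_left a_def sgn_eq)
  also have "\<dots> = complex_of_real (cmod (cinner x y))"
    using False unfolding complex_norm_square[symmetric] by (simp add: power2_eq_square)
  finally have "cmod (cinner x y) = Re (cinner (a *\<^sub>C x) y)"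
    by simp
  also have "\<dots> \<le> norm (a *\<^sub>C x) * norm y"
    unfolding Re_cinner by (rule norm_cauchy_schwarz)
  finally show ?thesis
    by (simp add: norm_scaleC a)
qed simp

lemma bounded_bilinear_cinner: "bounded_bilinear (cinner :: 'a::complex_inner \<Rightarrow> 'a \<Rightarrow> complex)"
proof
  show "\<exists>K. \<forall>x y :: 'a. cmod (cinner x y) \<le> norm x * norm y * K"
    by (rule exI[of _ 1]) (simp add: norm_cinner_le)
  fix r and x y :: 'a
  show "cinner (r *\<^sub>R x) y = r *\<^sub>R cinner x y"
    by (metis cinner_scaleC_left scaleC_of_real scaleR_conv_of_real)
  show "cinner x (r *\<^sub>R y) = r *\<^sub>R cinner x y"
    by (metis cinner_scaleC_right scaleC_of_real scaleR_conv_of_real complex_cnj_complex_of_real)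
qed (fact cinner_add_left cinner_add_right)+

interpretation cinner: bounded_bilinear "cinner :: 'a::complex_inner \<Rightarrow> 'a \<Rightarrow> complex"
  by (fact bounded_bilinear_cinner)

lemma cinner_eqI:
  fixes x y :: "'a::complex_inner"
  assumes "\<And>z. cinner z x = cinner z y"
  shows "x = y"
proof -
  have "cinner (x - y) (x - y) = 0"
    using assms by (simp add: cinner.diff_right)
  then show ?thesis
    by (simp add: cinner_eq_zero_iff)
qed


section \<open>Orthonormal sequences and projections\<close>

text \<open>The index set lets the finite stages of Gram-Schmidt and full sequences share one
  notion.\<close>

definition orthonormal_on :: "nat set \<Rightarrow> (nat \<Rightarrow> 'a::complex_inner) \<Rightarrow> bool"
  where "orthonormal_on I e \<longleftrightarrow> (\<forall>i\<in>I. \<forall>j\<in>I. cinner (e i) (e j) = (if i = j then 1 else 0))"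

text \<open>For \<open>e\<close> orthonormal on \<open>{..<n}\<close> this is the orthogonal
  projection onto the span of \<open>e 0, ..., e (n - 1)\<close>.\<close>

definition proj :: "(nat \<Rightarrow> 'a::complex_inner) \<Rightarrow> nat \<Rightarrow> 'a \<Rightarrow> 'a"
  where "proj e n x = (\<Sum>i<n. cinner x (e i) *\<^sub>C e i)"

text \<open>Completeness is expressed as convergence of the Fourier expansions, the form in which
  the limit arguments use it.\<close>

definition orthonormal_basis :: "(nat \<Rightarrow> 'a::complex_inner) \<Rightarrow> bool"
  where "orthonormal_basis e \<longleftrightarrow> orthonormal_on UNIV e \<and> (\<forall>x. (\<lambda>n. proj e n x) \<longlonglongrightarrow> x)"

lemma orthonormal_on_subset: "orthonormal_on J e \<Longrightarrow> I \<subseteq> J \<Longrightarrow> orthonormal_on I e"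
  unfolding orthonormal_on_def by blast

lemma cinner_orthonormal_sum:
  assumes "orthonormal_on I e" "finite A" "A \<subseteq> I" "j \<in> I"
  shows "cinner (\<Sum>i\<in>A. c i *\<^sub>C e i) (e j) = (if j \<in> A then c j else 0)"
proof -
  have "cinner (\<Sum>i\<in>A. c i *\<^sub>C e i) (e j) = (\<Sum>i\<in>A. if i = j then c i else 0)"
    unfolding cinner.sum_left
    by (rule sum.cong) (use assms in \<open>auto simp: orthonormal_on_def cinner_scaleC_left\<close>)
  then show ?thesis
    using assms(2) by simp
qed

lemma norm_orthonormal_sum:
  assumes "orthonormal_on I e" "finite A" "A \<subseteq> I"
  shows "(norm (\<Sum>i\<in>A. c i *\<^sub>C e i))\<^sup>2 = (\<Sum>i\<in>A. (cmod (c i))\<^sup>2)"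
proof -
  let ?s = "\<Sum>i\<in>A. c i *\<^sub>C e i"
  have "complex_of_real ((norm ?s)\<^sup>2) = (\<Sum>j\<in>A. cnj (c j) * cinner ?s (e j))"
    unfolding cinner_self[symmetric] by (simp add: cinner.sum_right cinner_scaleC_right)
  also have "\<dots> = (\<Sum>j\<in>A. cnj (c j) * c j)"
    by (rule sum.cong) (use assms in \<open>auto simp: cinner_orthonormal_sum subset_eq\<close>)
  also have "\<dots> = complex_of_real (\<Sum>j\<in>A. (cmod (c j))\<^sup>2)"
    by (simp only: of_real_sum complex_norm_square mult.commute)
  finally show ?thesis
    unfolding of_real_eq_iff .
qed

lemma proj_add: "proj e n (x + y) = proj e n x + proj e n y"
  by (simp add: proj_def cinner_add_left scaleC_add_left sum.distrib)

lemma proj_scaleC: "proj e n (a *\<^sub>C x) = a *\<^sub>C proj e n x"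
  by (simp add: proj_def cinner_scaleC_left complex_vector.scale_sum_right scaleC_scaleC)

lemma proj_diff: "proj e n (x - y) = proj e n x - proj e n y"
  by (metis proj_add add_diff_cancel eq_diff_eq)

lemma cinner_proj_left: "cinner (proj e n x) y = cinner x (proj e n y)"
  unfolding proj_def cinner.sum_left cinner.sum_right
  by (rule sum.cong) (simp_all add: cinner_scaleC_left cinner_scaleC_right cinner_commute[of "e _" y])

lemma cinner_proj_basis:
  assumes "orthonormal_on I e" "{..<n} \<subseteq> I" "j \<in> I"
  shows "cinner (proj e n x) (e j) = (if j < n then cinner x (e j) else 0)"
  unfolding proj_def using cinner_orthonormal_sum[OF assms(1) _ assms(2,3)] by simp

text \<open>The larger truncation keeps the first \<open>m\<close> coefficients of \<open>x\<close>;
  the case \<open>m = n\<close> is idempotence.\<close>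

lemma proj_proj:
  assumes "orthonormal_on {..<n} e" "m \<le> n"
  shows "proj e m (proj e n x) = proj e m x"
  unfolding proj_def[of e m]
  by (rule sum.cong) (use assms(2) in \<open>auto simp: cinner_proj_basis[OF assms(1)]\<close>)

text \<open>Self-adjointness and idempotence make \<open>proj e n x\<close> orthogonal to
  \<open>x - proj e n x\<close>; Pythagoras then bounds both parts.\<close>

lemma norm_proj_le:
  assumes "orthonormal_on {..<n} e"
  shows "norm (proj e n x) \<le> norm x" and "norm (x - proj e n x) \<le> norm x"
proof -
  have "cinner (proj e n x) (proj e n x) = cinner x (proj e n (proj e n x))"
    by (rule cinner_proj_left)
  also have "\<dots> = cinner (proj e n x) x"
    by (simp only: proj_proj[OF assms order_refl] cinner_proj_left)
  finally have "inner (proj e n x) (x - proj e n x) = 0"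
    by (simp only: Re_cinner[symmetric] cinner.diff_right) simp
  then have "(norm x)\<^sup>2 = (norm (proj e n x))\<^sup>2 + (norm (x - proj e n x))\<^sup>2"
    using norm_add_Pythagorean[of "proj e n x" "x - proj e n x"] by (simp add: orthogonal_def)
  then show "norm (proj e n x) \<le> norm x" "norm (x - proj e n x) \<le> norm x"
    by (simp_all add: power2_le_imp_le)
qed

text \<open>Best approximation: as \<open>y\<close> is fixed by the projection, \<open>x\<close> and
  \<open>x - y\<close> have the same remainder.\<close>

lemma norm_diff_proj_le:
  assumes "orthonormal_on {..<n} e" "proj e n y = y"
  shows "norm (x - proj e n x) \<le> norm (x - y)"
proof -
  have "x - proj e n x = (x - y) - proj e n (x - y)"
    by (simp add: proj_diff assms(2))
  then show ?thesis
    by (simp only: norm_proj_le(2)[OF assms(1)])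
qed

lemma proj_in_cspan: "proj e n x \<in> cspan (e ` {..<n})"
  unfolding proj_def
  by (intro complex_vector.span_sum complex_vector.span_scale complex_vector.span_base) auto

section \<open>Existence of orthonormal bases\<close>

text \<open>The new unit vector absorbs \<open>x\<close> into the span even when \<open>x\<close>
  already lies there, so the induction never has to skip a vector.\<close>

lemma Gram_Schmidt_step:
  fixes e :: "nat \<Rightarrow> 'a::complex_inner"
  assumes "infinite_dimensional TYPE('a)" and e: "orthonormal_on {..<n} e"
  shows "\<exists>v. norm v = 1 \<and> (\<forall>i<n. cinner v (e i) = 0) \<and> x = proj e n x + cinner x v *\<^sub>C v"
proof -
  \<comment> \<open>The witness is the normalised residual of \<open>y\<close>. It serves twice:
    with \<open>y = x\<close> if \<open>x\<close> has a nonzero residual, and otherwise with an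
    auxiliary vector.\<close>
  have normalise: "\<exists>v. norm v = 1 \<and> (\<forall>i<n. cinner v (e i) = 0) \<and>
      y = proj e n y + cinner y v *\<^sub>C v" if "y \<noteq> proj e n y" for y
  proof -
    define r where "r = y - proj e n y"
    define c where "c = complex_of_real (1 / norm r)"
    have r: "r \<noteq> 0"
      using that by (simp add: r_def)
    have orth: "cinner r (e i) = 0" if "i < n" for i
      using that by (simp add: r_def cinner.diff_left cinner_proj_basis[OF e])
    have "cinner (proj e n y) r = 0"
      unfolding proj_def cinner.sum_left
      by (rule sum.neutral) (auto simp: cinner_scaleC_left orth cinner_commute[of "e _" r])
    moreover have "cinner y r = cinner (proj e n y) r + cinner r r"
      by (simp add: r_def flip: cinner_add_left)
    ultimately have "cinner y r = complex_of_real ((norm r)\<^sup>2)"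
      by (simp add: cinner_self)
    then have "cinner y (c *\<^sub>C r) *\<^sub>C c *\<^sub>C r = r"
      using r by (simp add: c_def cinner_scaleC_right scaleC_scaleC power2_eq_square scaleC_one)
    then have "norm (c *\<^sub>C r) = 1 \<and> (\<forall>i<n. cinner (c *\<^sub>C r) (e i) = 0) \<and>
        y = proj e n y + cinner y (c *\<^sub>C r) *\<^sub>C c *\<^sub>C r"
      using r by (simp add: norm_scaleC c_def norm_divide cinner_scaleC_left orth) (simp add: r_def)
    then show ?thesis
      by blast
  qed
  show ?thesis
  proof (cases "x = proj e n x")
    case True
    \<comment> \<open>Here the coefficient of \<open>x\<close> along \<open>v\<close> must vanish,
      so any unit vector orthogonal to the first \<open>n\<close> will do; infinite dimension
      supplies one.\<close>
    obtain w where "w \<notin> cspan (e ` {..<n})"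
      using assms(1) unfolding infinite_dimensional_def by blast
    then have "w \<noteq> proj e n w"
      using proj_in_cspan[of e n w] by auto
    from normalise[OF this] obtain v where v: "norm v = 1" "\<forall>i<n. cinner v (e i) = 0"
      by blast
    have "cinner (proj e n x) v = 0"
      unfolding proj_def cinner.sum_left
      by (rule sum.neutral) (use v(2) in \<open>auto simp: cinner_scaleC_left cinner_commute[of "e _" v]\<close>)
    then show ?thesis
      using v True by auto
  qed (fact normalise)
qed

text \<open>Gram-Schmidt along a dense sequence \<open>d\<close>. Each \<open>d m\<close> is fixed
  by all later projections, so best approximation carries convergence from the dense set to every
  \<open>x\<close>.\<close>

lemma orthonormal_basis_exists:
  assumes "separable_space (euclidean :: 'a::complex_hilbert topology)"
    and "infinite_dimensional TYPE('a)"
  shows "\<exists>e :: nat \<Rightarrow> 'a. orthonormal_basis e"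
proof -
  obtain D :: "'a set" where D: "countable D" "closure D = UNIV"
    using assms(1) by (auto simp: separable_space_def)
  then have "D \<noteq> {}"
    by auto
  define d where "d = from_nat_into D"
  have "range d = D"
    unfolding d_def using D(1) \<open>D \<noteq> {}\<close> by simp
  have proj_cong: "proj f n x = proj g n x" if "\<And>i. i < n \<Longrightarrow> f i = g i" for f g :: "nat \<Rightarrow> 'a" and n x
    unfolding proj_def using that by (intro sum.cong) auto
  have orthonormal_if: "orthonormal_on {..<n} f"
    if "\<And>m. m < n \<Longrightarrow> norm (f m) = 1 \<and> (\<forall>i<m. cinner (f m) (f i) = 0)" for f :: "nat \<Rightarrow> 'a" and n
    unfolding orthonormal_on_def
  proof (intro ballI)
    fix i j assume "i \<in> {..<n}" "j \<in> {..<n}"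
    then show "cinner (f i) (f j) = (if i = j then 1 else 0)"
      using that[of i] that[of j] cinner_commute[of "f i" "f j"]
      by (cases i j rule: linorder_cases) (auto simp: cinner_self)
  qed
  \<comment> \<open>Course-of-values choice: the condition on \<open>e n\<close> involves only
    earlier values, which \<open>proj_cong\<close> confirms for the projection term.\<close>
  have "\<exists>e. \<forall>n. norm (e n) = 1 \<and> (\<forall>i<n. cinner (e n) (e i) = 0) \<and>
      d n = proj e n (d n) + cinner (d n) (e n) *\<^sub>C e n"
  proof (rule dependent_wellorder_choice)
    fix r and f g :: "nat \<Rightarrow> 'a" and n
    assume "\<And>m. m < n \<Longrightarrow> f m = g m"
    then show "(norm r = 1 \<and> (\<forall>i<n. cinner r (f i) = 0) \<and> d n = proj f n (d n) + cinner (d n) r *\<^sub>C r) =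
        (norm r = 1 \<and> (\<forall>i<n. cinner r (g i) = 0) \<and> d n = proj g n (d n) + cinner (d n) r *\<^sub>C r)"
      using proj_cong[of n f g "d n"] by simp
  next
    fix n and f :: "nat \<Rightarrow> 'a"
    assume "\<And>m. m < n \<Longrightarrow> norm (f m) = 1 \<and> (\<forall>i<m. cinner (f m) (f i) = 0) \<and>
        d m = proj f m (d m) + cinner (d m) (f m) *\<^sub>C f m"
    then show "\<exists>r. norm r = 1 \<and> (\<forall>i<n. cinner r (f i) = 0) \<and>
        d n = proj f n (d n) + cinner (d n) r *\<^sub>C r"
      by (intro Gram_Schmidt_step assms(2) orthonormal_if) auto
  qed
  \<comment> \<open>The step from \<open>proj e n\<close> to \<open>proj e (Suc n)\<close> adds
    exactly the chosen term, so \<open>d n\<close> is fixed by the latter.\<close>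
  then obtain e where e: "\<And>n. norm (e n) = 1 \<and> (\<forall>i<n. cinner (e n) (e i) = 0)"
      "\<And>n. d n = proj e (Suc n) (d n)"
    by (auto simp: proj_def)
  have on: "orthonormal_on {..<n} e" for n
    by (rule orthonormal_if) (use e(1) in auto)
  have "orthonormal_on UNIV e"
    unfolding orthonormal_on_def
  proof (intro ballI)
    fix i j
    show "cinner (e i) (e j) = (if i = j then 1 else 0)"
      using on[of "Suc (max i j)"] by (auto simp: orthonormal_on_def)
  qed
  have d: "proj e n (d m) = d m" if "m < n" for m n
  proof -
    have "proj e n (d m) = proj e n (proj e (Suc m) (d m))"
      using e(2) by simp
    also have "\<dots> = proj e (Suc m) (d m)"
    \<comment> \<open>\<open>proj_proj\<close> wants the smaller projection outside; moving both
      onto \<open>z\<close> by self-adjointness reverses their order.\<close>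
    proof (rule cinner_eqI)
      fix z
      show "cinner z (proj e n (proj e (Suc m) (d m))) = cinner z (proj e (Suc m) (d m))"
        unfolding cinner_proj_left[symmetric] proj_proj[OF on Suc_leI[OF that]] ..
    qed
    finally show ?thesis
      using e(2) by simp
  qed
  have "(\<lambda>n. proj e n x) \<longlonglongrightarrow> x" for x
  proof (rule LIMSEQ_I)
    fix r :: real assume "0 < r"
    then obtain m where m: "dist (d m) x < r"
      using D(2) \<open>range d = D\<close> by (metis UNIV_I closure_approachable imageE)
    have "norm (proj e n x - x) < r" if "n \<ge> Suc m" for n
      using norm_diff_proj_le[OF on d[of m n], of x] that m
      by (simp add: norm_minus_commute dist_norm)
    then show "\<exists>no. \<forall>n\<ge>no. norm (proj e n x - x) < r"
      by blast
  qed
  then show ?thesis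
    using \<open>orthonormal_on UNIV e\<close> orthonormal_basis_def by blast
qed


section \<open>Convergence of orthonormal series\<close>

instance complex_hilbert \<subseteq> banach ..

text \<open>Riesz-Fischer: by Pythagoras, bounded partial sums make the squared coefficients
  summable, and the Cauchy condition for these squares is the one for the series.\<close>

lemma orthonormal_summable:
  fixes e :: "nat \<Rightarrow> 'a::complex_hilbert"
  assumes e: "orthonormal_on UNIV e" and "\<And>n. norm (\<Sum>i<n. c i *\<^sub>C e i) \<le> B"
  shows "summable (\<lambda>i. c i *\<^sub>C e i)"
proof -
  have norm_sum: "(norm (\<Sum>i\<in>A. c i *\<^sub>C e i))\<^sup>2 = (\<Sum>i\<in>A. (cmod (c i))\<^sup>2)" if "finite A" for A
    using norm_orthonormal_sum[OF e that] by simp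
  have "(\<Sum>i<n. (cmod (c i))\<^sup>2) \<le> B\<^sup>2" for n
    unfolding norm_sum[symmetric, OF finite_lessThan] using assms(2) by (intro power_mono) auto
  then have "summable (\<lambda>i. (cmod (c i))\<^sup>2)"
    by (intro summableI_nonneg_bounded) auto
  show ?thesis
    unfolding summable_Cauchy
  proof (intro allI impI)
    fix r :: real assume "0 < r"
    then have "0 < r\<^sup>2"
      by simp
    then obtain N where N: "\<And>m n. m \<ge> N \<Longrightarrow> norm (\<Sum>i=m..<n. (cmod (c i))\<^sup>2) < r\<^sup>2"
      using \<open>summable (\<lambda>i. (cmod (c i))\<^sup>2)\<close> unfolding summable_Cauchy by blast
    have "norm (\<Sum>i=m..<n. c i *\<^sub>C e i) < r" if "m \<ge> N" for m n
    proof (rule power2_less_imp_less)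
      show "(norm (\<Sum>i=m..<n. c i *\<^sub>C e i))\<^sup>2 < r\<^sup>2"
        using N[OF that, of n] by (simp add: norm_sum)
    qed (use \<open>0 < r\<close> in simp)
    then show "\<exists>N. \<forall>m\<ge>N. \<forall>n. norm (\<Sum>i=m..<n. c i *\<^sub>C e i) < r"
      by blast
  qed
qed


section \<open>Adjoints\<close>

lemma bounded_operatorsD:
  assumes "T \<in> bounded_operators"
  shows "bounded_linear T" "T (a *\<^sub>C x) = a *\<^sub>C T x"
  using assms by (auto simp: bounded_operators_def)

lemma bounded_operators_compose:
  assumes "S \<in> bounded_operators" "T \<in> bounded_operators"
  shows "(\<lambda>x. S (T x)) \<in> bounded_operators"
  using assms by (simp add: bounded_operators_def bounded_linear_compose)

lemma bounded_operators_add: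
  assumes "S \<in> bounded_operators" "T \<in> bounded_operators"
  shows "(\<lambda>x. S x + T x) \<in> bounded_operators"
  using assms by (simp add: bounded_operators_def bounded_linear_add scaleC_add_right)

lemma proj_bounded_operator:
  fixes e :: "nat \<Rightarrow> 'a::complex_hilbert"
  assumes "orthonormal_on {..<n} e"
  shows "proj e n \<in> bounded_operators"
  unfolding bounded_operators_def
proof (intro CollectI conjI allI)
  show "bounded_linear (proj e n)"
  proof (rule bounded_linear_intro)
    show "norm (proj e n x) \<le> norm x * 1" for x
      using norm_proj_le(1)[OF assms] by simp
    show "proj e n (r *\<^sub>R x) = r *\<^sub>R proj e n x" for r x
      by (metis proj_scaleC scaleC_of_real)
  qed (fact proj_add)
qed (fact proj_scaleC)

text \<open>The Riesz representation is made explicit: the adjoint at \<open>y\<close> is the series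
  with coefficients \<open>cinner y (T (e i))\<close> along \<open>e\<close>.\<close>

lemma adjoint_exists:
  fixes e :: "nat \<Rightarrow> 'h::complex_hilbert" and T :: "'h \<Rightarrow> 'k::complex_hilbert"
  assumes e: "orthonormal_basis e" and T: "T \<in> bounded_operators"
  shows "\<exists>S\<in>bounded_operators. \<forall>x y. cinner (T x) y = cinner x (S y)"
proof -
  note lin = bounded_operatorsD(1)[OF T]
  have on: "orthonormal_on UNIV e" and lim: "(\<lambda>n. proj e n x) \<longlonglongrightarrow> x" for x
    using e by (auto simp: orthonormal_basis_def)
  obtain K where K: "\<And>x. norm (T x) \<le> norm x * K" "K \<ge> 0"
    using bounded_linear.nonneg_bounded[OF lin] by blast
  have sum_eq: "cinner (T (proj e n x)) y = cinner x (\<Sum>i<n. cinner y (T (e i)) *\<^sub>C e i)" for n x y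
    unfolding proj_def
    by (simp add: linear_sum[OF bounded_linear.linear[OF lin]] bounded_operatorsD(2)[OF T]
        cinner.sum_left cinner.sum_right cinner_scaleC_left cinner_scaleC_right
        cinner_commute[of "T _" y] mult.commute)
  have "\<exists>s. \<forall>x. cinner (T x) y = cinner x s" for y
  proof -
    let ?s = "\<lambda>n. \<Sum>i<n. cinner y (T (e i)) *\<^sub>C e i"
    have "norm (?s n) \<le> K * norm y" for n
    proof -
      \<comment> \<open>Testing \<open>sum_eq\<close> at \<open>x = ?s n\<close> itself gives the
        squared norm; cancelling one factor leaves a bound independent of \<open>n\<close>.\<close>
      have "proj e n (?s n) = ?s n"
        unfolding proj_def
        by (rule sum.cong) (auto simp: cinner_orthonormal_sum[OF on])
      then have "(norm (?s n))\<^sup>2 = cmod (cinner (T (?s n)) y)"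
        using sum_eq[of n "?s n" y] by (simp add: cinner_self norm_power)
      also have "\<dots> \<le> norm (T (?s n)) * norm y"
        by (rule norm_cinner_le)
      also have "\<dots> \<le> (norm (?s n) * K) * norm y"
        by (intro mult_right_mono K) auto
      finally show ?thesis
        using K(2) by (cases "norm (?s n) = 0") (auto simp: power2_eq_square mult_ac)
    qed
    then have s: "?s \<longlonglongrightarrow> (\<Sum>i. cinner y (T (e i)) *\<^sub>C e i)" (is "_ \<longlonglongrightarrow> ?t")
      by (rule summable_LIMSEQ[OF orthonormal_summable[OF on]])
    have "cinner (T x) y = cinner x ?t" for x
    proof (rule LIMSEQ_unique)
      show "(\<lambda>n. cinner (T (proj e n x)) y) \<longlonglongrightarrow> cinner (T x) y"
        by (intro cinner.tendsto bounded_linear.tendsto[OF lin] lim tendsto_const)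
      show "(\<lambda>n. cinner (T (proj e n x)) y) \<longlonglongrightarrow> cinner x ?t"
        unfolding sum_eq by (intro cinner.tendsto s tendsto_const)
    qed
    then show ?thesis
      by blast
  qed
  then obtain S where S: "\<And>x y. cinner (T x) y = cinner x (S y)"
    by metis
  have "norm (S y) \<le> norm y * K" for y
  proof -
    \<comment> \<open>The same self-testing, now with \<open>x = S y\<close>, bounds the adjoint by
      the constant of \<open>T\<close>.\<close>
    have "(norm (S y))\<^sup>2 = cmod (cinner (T (S y)) y)"
      unfolding S by (simp add: cinner_self norm_power)
    also have "\<dots> \<le> (norm (S y) * K) * norm y"
      by (rule order_trans[OF norm_cinner_le]) (intro mult_right_mono K, auto)
    finally show ?thesis
      using K(2) by (cases "norm (S y) = 0") (auto simp: power2_eq_square mult_ac)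
  qed
  moreover have "S (y + z) = S y + S z" "S (a *\<^sub>C y) = a *\<^sub>C S y" for y z a
    by (rule cinner_eqI; simp add: cinner_add_right cinner_scaleC_right flip: S)+
  ultimately have "S \<in> bounded_operators"
    unfolding bounded_operators_def
    by (auto intro!: bounded_linear_intro[of S K] simp flip: scaleC_of_real)
  then show ?thesis
    using S by blast
qed


section \<open>Antilinear isometries\<close>

text \<open>For orthonormal \<open>e\<close> and \<open>g\<close>, the antilinear map taking
  \<open>e i\<close> to \<open>g i\<close> and killing whatever is orthogonal to all
  \<open>e i\<close>. Exchanging \<open>e\<close> and \<open>g\<close> gives the partner
  map.\<close>

definition antilinear_extension ::
    "(nat \<Rightarrow> 'h::complex_hilbert) \<Rightarrow> (nat \<Rightarrow> 'k::complex_hilbert) \<Rightarrow> 'h \<Rightarrow> 'k"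
  where "antilinear_extension e g x = (\<Sum>i. cnj (cinner x (e i)) *\<^sub>C g i)"

text \<open>The partial sums have the same norm as \<open>proj e n x\<close>, hence are bounded by
  \<open>norm x\<close>.\<close>

lemma antilinear_extension_sums:
  assumes e: "orthonormal_on UNIV e" and g: "orthonormal_on UNIV g"
  shows "(\<lambda>i. cnj (cinner x (e i)) *\<^sub>C g i) sums antilinear_extension e g x"
  unfolding antilinear_extension_def
proof (rule summable_sums, rule orthonormal_summable[OF g])
  fix n
  have "(norm (\<Sum>i<n. cnj (cinner x (e i)) *\<^sub>C g i))\<^sup>2 = (norm (proj e n x))\<^sup>2"
    unfolding proj_def by (simp add: norm_orthonormal_sum[OF g] norm_orthonormal_sum[OF e])
  also have "\<dots> \<le> (norm x)\<^sup>2"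
    by (intro power_mono norm_proj_le orthonormal_on_subset[OF e]) auto
  finally show "norm (\<Sum>i<n. cnj (cinner x (e i)) *\<^sub>C g i) \<le> norm x"
    by (rule power2_le_imp_le) simp
qed

text \<open>Both sides expand into the same numerical series. This is the compatibility condition of
  a conjugation pair.\<close>

lemma antilinear_extension_adjoint:
  assumes e: "orthonormal_on UNIV e" and g: "orthonormal_on UNIV g"
  shows "cinner (antilinear_extension e g x) y = cinner (antilinear_extension g e y) x"
proof (rule sums_unique2)
  show "(\<lambda>i. cnj (cinner x (e i)) * cinner (g i) y) sums cinner (antilinear_extension e g x) y"
    using bounded_linear.sums[OF cinner.bounded_linear_left antilinear_extension_sums[OF e g]] by (simp add: cinner_scaleC_left)
  have "(\<lambda>i. cnj (cinner y (g i)) * cinner (e i) x) sums cinner (antilinear_extension g e y) x"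
    using bounded_linear.sums[OF cinner.bounded_linear_left antilinear_extension_sums[OF g e]] by (simp add: cinner_scaleC_left)
  then show "(\<lambda>i. cnj (cinner x (e i)) * cinner (g i) y) sums cinner (antilinear_extension g e y) x"
    by (simp add: mult.commute flip: cinner_commute)
qed


lemma antilinear_extension_basis:
  assumes e: "orthonormal_on UNIV e" and g: "orthonormal_on UNIV g"
  shows "antilinear_extension e g (e j) = g j"
proof -
  have "(\<lambda>i. cnj (cinner (e j) (e i)) *\<^sub>C g i) = (\<lambda>i. if i = j then g i else 0)"
    using e by (auto simp: orthonormal_on_def scaleC_one)
  then have "(\<lambda>i. if i = j then g i else 0) sums antilinear_extension e g (e j)"
    using antilinear_extension_sums[OF e g, of "e j"] by simp
  then show ?thesis
    by (rule sums_unique2[OF _ sums_single])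
qed

text \<open>Conjugating the coefficients twice restores the Fourier series of \<open>x\<close>,
  which sums to \<open>x\<close> because \<open>e\<close> is complete.\<close>

lemma antilinear_extension_inverse:
  assumes e: "orthonormal_basis e" and g: "orthonormal_on UNIV g"
  shows "antilinear_extension g e (antilinear_extension e g x) = x"
proof (rule sums_unique2)
  have on: "orthonormal_on UNIV e"
    using e by (simp add: orthonormal_basis_def)
  have "cnj (cinner (antilinear_extension e g x) (g i)) = cinner x (e i)" for i
    unfolding antilinear_extension_adjoint[OF on g] antilinear_extension_basis[OF g on]
    by (rule cinner_commute[symmetric])
  then show "(\<lambda>i. cinner x (e i) *\<^sub>C e i) sums
      antilinear_extension g e (antilinear_extension e g x)"
    using antilinear_extension_sums[OF g on, of "antilinear_extension e g x"] by simp
  show "(\<lambda>i. cinner x (e i) *\<^sub>C e i) sums x"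
    using e by (simp add: sums_def orthonormal_basis_def proj_def)
qed

text \<open>The identity moves \<open>x\<close> out of \<open>C1\<close> into a linear slot, while
  \<open>C1 x\<close> sits in a conjugate-linear one; antilinearity follows.\<close>

lemma conjugate_linearI:
  assumes adj: "\<And>x y. cinner (C1 x) y = cinner (C2 y) x"
  shows "conjugate_linear C1"
proof -
  have eq: "cinner z (C1 x) = cinner x (C2 z)" for x z
    using adj cinner_commute by metis
  show ?thesis
    unfolding conjugate_linear_def
    by (intro conjI allI; rule cinner_eqI;
        simp add: eq cinner_add_left cinner_add_right cinner_scaleC_left cinner_scaleC_right)
qed

text \<open>\<open>bounded_linear\<close> is a real-linear notion, so antilinear contractions
  qualify and its rules apply to them.\<close>

lemma conjugate_linear_bounded_linear:
  assumes "conjugate_linear C" "\<And>x. norm (C x) \<le> norm x"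
  shows "bounded_linear C"
proof (rule bounded_linear_intro)
  show "C (r *\<^sub>R x) = r *\<^sub>R C x" for r x
    using assms(1) unfolding conjugate_linear_def
    by (metis complex_cnj_complex_of_real scaleC_of_real)
  show "norm (C x) \<le> norm x * 1" for x
    using assms(2) by simp
qed (use assms(1) in \<open>simp add: conjugate_linear_def\<close>)

section \<open>Isometric conjugation pairs and symmetrization\<close>

locale isometric_conjugation_pair =
  fixes C1 :: "'h::complex_hilbert \<Rightarrow> 'k::complex_hilbert" and C2 :: "'k \<Rightarrow> 'h"
  assumes adj: "cinner (C1 x) y = cinner (C2 y) x"
    and inverse: "C2 (C1 x) = x"
begin

lemma conjugate_linear: "conjugate_linear C1" "conjugate_linear C2"
  using conjugate_linearI[of C1 C2] conjugate_linearI[of C2 C1] by (simp_all add: adj)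

lemma norm_C1: "norm (C1 x) = norm x"
proof -
  have "complex_of_real ((norm (C1 x))\<^sup>2) = complex_of_real ((norm x)\<^sup>2)"
    by (simp only: cinner_self[symmetric] adj inverse)
  then show ?thesis
    unfolding of_real_eq_iff by (simp add: power2_eq_iff_nonneg)
qed

text \<open>Testing \<open>adj\<close> at \<open>x = C2 y\<close> and using that \<open>C1\<close>
  is isometric, Cauchy-Schwarz yields the contraction.\<close>

lemma norm_C2_le: "norm (C2 y) \<le> norm y"
proof -
  have "(norm (C2 y))\<^sup>2 = cmod (cinner (C1 (C2 y)) y)"
    unfolding adj cinner_self by (simp add: norm_power)
  also have "\<dots> \<le> norm (C2 y) * norm y"
    using norm_cinner_le[of "C1 (C2 y)" y] by (simp add: norm_C1)
  finally show ?thesis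
    by (cases "C2 y = 0") (auto simp: power2_eq_square)
qed

lemma bounded_linear: "bounded_linear C1" "bounded_linear C2"
  using conjugate_linear_bounded_linear conjugate_linear norm_C1 norm_C2_le by force+

lemma conjugation_pair: "conjugation_pair C1 C2"
  unfolding conjugation_pair_def using conjugate_linear adj inverse by (auto simp: fun_eq_iff)

text \<open>With \<open>S\<close> the symmetrized operator, cancelling \<open>C2 C1\<close> turns
  both \<open>C2 S\<close> and \<open>S* C1\<close> into \<open>C2 T + Ts C1\<close>.\<close>

lemma symmetrization:
  assumes T: "T \<in> bounded_operators" and Ts: "Ts \<in> bounded_operators"
    and T_adj: "\<And>x y. cinner (T x) y = cinner x (Ts y)"
  shows "cadjoint (\<lambda>x. T x + C1 (Ts (C1 x))) = (\<lambda>y. Ts y + C2 (T (C2 y)))" (is "cadjoint ?S = ?R")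
    and "(\<lambda>x. T x + C1 (Ts (C1 x))) \<in> CSO_b"
proof -
  have add: "C1 (x + x') = C1 x + C1 x'" "C2 (y + y') = C2 y + C2 y'" for x x' y y'
    using conjugate_linear by (simp_all add: conjugate_linear_def)
  have scale: "C1 (a *\<^sub>C x) = cnj a *\<^sub>C C1 x" for a x
    using conjugate_linear by (simp add: conjugate_linear_def)
  have adj': "cinner y (C1 x) = cinner x (C2 y)" for x y
    using adj cinner_commute by metis
  \<comment> \<open>Two antilinear moves and one linear one: the adjoint of \<open>C1 Ts C1\<close>
    is \<open>C2 T C2\<close>.\<close>
  have "cinner (C1 (Ts (C1 x))) y = cinner x (C2 (T (C2 y)))" for x y
    unfolding adj T_adj[symmetric] adj' ..
  then show S_adj: "cadjoint ?S = ?R"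
    by (intro cadjoint_eqI) (simp add: cinner_add_left cinner_add_right T_adj)
  have "(\<lambda>x. C1 (Ts (C1 x))) \<in> bounded_operators"
    unfolding bounded_operators_def
    using bounded_linear_compose[OF bounded_linear(1)
        bounded_linear_compose[OF bounded_operatorsD(1)[OF Ts] bounded_linear(1)]]
    by (simp add: scale bounded_operatorsD(2)[OF Ts])
  then have "?S \<in> bounded_operators"
    using T by (rule bounded_operators_add[rotated])
  moreover have "pair_symmetric C1 C2 ?S"
    unfolding pair_symmetric_def S_adj
    by (auto simp: fun_eq_iff add inverse add.commute)
  ultimately show "?S \<in> CSO_b"
    unfolding CSO_b_def using conjugation_pair by blast
qed

end


section \<open>Density\<close>

lemma proj_tendsto:
  assumes f: "orthonormal_basis f" and "y \<longlonglongrightarrow> l"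
  shows "(\<lambda>n. proj f n (y n)) \<longlonglongrightarrow> l"
proof -
  have on: "orthonormal_on {..<n} f" for n
    using f by (simp_all add: orthonormal_basis_def orthonormal_on_subset[OF _ subset_UNIV])
  have "(\<lambda>n. proj f n (y n - l)) \<longlonglongrightarrow> 0"
  proof (rule Lim_null_comparison)
    show "\<forall>\<^sub>F n in sequentially. norm (proj f n (y n - l)) \<le> norm (y n - l)"
      using norm_proj_le(1)[OF on] by simp
    show "(\<lambda>n. norm (y n - l)) \<longlonglongrightarrow> 0"
      using assms(2) by (simp add: LIM_zero tendsto_norm_zero)
  qed
  moreover have "(\<lambda>n. proj f n l) \<longlonglongrightarrow> l"
    using f by (simp add: orthonormal_basis_def)
  ultimately show ?thesis
    using tendsto_add[of "\<lambda>n. proj f n (y n - l)" 0 sequentially "\<lambda>n. proj f n l" l]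
    by (simp flip: proj_add)
qed

lemma symmetrized_truncation_tendsto:
  assumes e: "orthonormal_basis e" and f: "orthonormal_basis f"
    and T: "T \<in> bounded_operators" and S: "S \<in> bounded_operators"
    and C: "\<And>n. bounded_linear (C n)" "\<And>n x. norm (C n x) \<le> norm x"
    and off_diagonal: "\<And>n x. proj f n (C n (proj e n x)) = 0"
  shows "(\<lambda>n. proj f n (T (proj e n x)) + C n (proj e n (S (proj f n (C n x))))) \<longlonglongrightarrow> T x"
proof -
  have on: "orthonormal_on {..<n} e" "orthonormal_on {..<n} f" for n
    using e f by (simp_all add: orthonormal_basis_def orthonormal_on_subset[OF _ subset_UNIV])
  have lim: "(\<lambda>n. proj e n x) \<longlonglongrightarrow> x"
    using e by (simp add: orthonormal_basis_def)
  obtain K where K: "\<And>y. norm (S y) \<le> norm y * K" "K \<ge> 0"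
    using bounded_linear.nonneg_bounded[OF bounded_operatorsD(1)[OF S]] by blast
  have "(\<lambda>n. proj f n (T (proj e n x))) \<longlonglongrightarrow> T x"
    by (intro proj_tendsto f bounded_linear.tendsto[OF bounded_operatorsD(1)[OF T]] lim)
  moreover have "(\<lambda>n. C n (proj e n (S (proj f n (C n x))))) \<longlonglongrightarrow> 0"
  proof (rule Lim_null_comparison)
    have "norm (C n (proj e n (S (proj f n (C n x))))) \<le> norm (x - proj e n x) * K" for n
    proof -
      have "proj f n (C n x) = proj f n (C n (x - proj e n x))"
        by (simp add: linear_diff[OF bounded_linear.linear[OF C(1)]] proj_diff off_diagonal)
      then have "norm (proj f n (C n x)) \<le> norm (x - proj e n x)"
        using order_trans[OF norm_proj_le(1)[OF on(2)] C(2)] by simp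
      then have "norm (S (proj f n (C n x))) \<le> norm (x - proj e n x) * K"
        by (intro order_trans[OF K(1)] mult_right_mono K(2))
      then show ?thesis
        by (intro order_trans[OF C(2)] order_trans[OF norm_proj_le(1)[OF on(1)]])
    qed
    then show "\<forall>\<^sub>F n in sequentially.
        norm (C n (proj e n (S (proj f n (C n x))))) \<le> norm (x - proj e n x) * K"
      by simp
    have "(\<lambda>n. norm (x - proj e n x)) \<longlonglongrightarrow> norm (x - x)"
      by (intro tendsto_intros lim)
    then show "(\<lambda>n. norm (x - proj e n x) * K) \<longlonglongrightarrow> 0"
      by (simp add: tendsto_mult_left_zero)
  qed
  ultimately show ?thesis
    using tendsto_add[of _ "T x" sequentially _ 0] by simp
qed

definition block_swap :: "nat \<Rightarrow> nat \<Rightarrow> nat"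
  where "block_swap n i = (if i < n then i + n else if i < 2 * n then i - n else i)"

lemma inj_block_swap: "inj (block_swap n)"
  unfolding inj_def block_swap_def by auto

lemma proj_eq_0:
  assumes "\<And>i. i < n \<Longrightarrow> cinner x (e i) = 0"
  shows "proj e n x = 0"
  unfolding proj_def by (rule sum.neutral) (simp add: assms)

lemma CSO_b_sequence:
  fixes T :: "'h::complex_hilbert \<Rightarrow> 'k::complex_hilbert"
    and e :: "nat \<Rightarrow> 'h" and f :: "nat \<Rightarrow> 'k"
  assumes e: "orthonormal_basis e" and f: "orthonormal_basis f" and T: "T \<in> bounded_operators"
  shows "\<exists>S :: nat \<Rightarrow> 'h \<Rightarrow> 'k. range S \<subseteq> CSO_b \<and> limitin SST S T sequentially"
proof -
  obtain Ts where Ts: "Ts \<in> bounded_operators" and T_adj: "\<And>x y. cinner (T x) y = cinner x (Ts y)"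
    using adjoint_exists[OF e T] by blast
  have on: "orthonormal_on UNIV e" "orthonormal_on UNIV f"
    using e f by (auto simp: orthonormal_basis_def)
  define g where "g = (\<lambda>n i. f (block_swap n i))"
  have g: "orthonormal_on UNIV (g n)" for n
    using on(2) inj_block_swap[of n] by (auto simp: orthonormal_on_def g_def inj_eq)
  define C1 where "C1 = (\<lambda>n. antilinear_extension e (g n))"
  define C2 where "C2 = (\<lambda>n. antilinear_extension (g n) e)"
  interpret isometric_conjugation_pair "C1 n" "C2 n" for n
    unfolding C1_def C2_def
    by unfold_locales
      (simp_all add: antilinear_extension_adjoint[OF on(1) g] antilinear_extension_inverse[OF e g])
  have basis: "C1 n (e i) = g n i" "C2 n (g n i) = e i" for n i
    by (simp_all add: C1_def C2_def antilinear_extension_basis on g)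
  have orth: "cinner (e (i + n)) (proj e n x) = 0" "cinner (f (i + n)) (proj f n y) = 0" for i n x y
    unfolding cinner_commute[of "e _"] cinner_commute[of "f _"]
    using cinner_proj_basis[OF on(1)] cinner_proj_basis[OF on(2)] by simp_all
  have off_diagonal1: "proj f n (C1 n (proj e n x)) = 0" for n x
  proof (rule proj_eq_0)
    fix i assume "i < n"
    then have "f i = g n (i + n)"
      by (simp add: g_def block_swap_def)
    then show "cinner (C1 n (proj e n x)) (f i) = 0"
      by (simp add: adj basis orth)
  qed
  have off_diagonal2: "proj e n (C2 n (proj f n y)) = 0" for n y
  proof (rule proj_eq_0)
    fix i assume "i < n"
    then have "g n i = f (i + n)"
      by (simp add: g_def block_swap_def)
    then show "cinner (C2 n (proj f n y)) (e i) = 0"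
      by (simp add: basis orth flip: adj)
  qed
  define A where "A = (\<lambda>n x. proj f n (T (proj e n x)))"
  define B where "B = (\<lambda>n y. proj e n (Ts (proj f n y)))"
  define S where "S = (\<lambda>n x. A n x + C1 n (B n (C1 n x)))"
  have proj_op: "proj e n \<in> bounded_operators" "proj f n \<in> bounded_operators" for n
    using on by (simp_all add: proj_bounded_operator orthonormal_on_subset[OF _ subset_UNIV])
  have AB: "A n \<in> bounded_operators" "B n \<in> bounded_operators" for n
    unfolding A_def B_def
    using bounded_operators_compose[OF proj_op(2) bounded_operators_compose[OF T proj_op(1)]]
      bounded_operators_compose[OF proj_op(1) bounded_operators_compose[OF Ts proj_op(2)]]
    by simp_all
  have AB_adj: "cinner (A n x) y = cinner x (B n y)" for n x y
    unfolding A_def B_def by (simp only: cinner_proj_left T_adj)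
  have S_adj: "cadjoint (S n) = (\<lambda>y. B n y + C2 n (A n (C2 n y)))" for n
    unfolding S_def by (rule symmetrization(1)[OF AB AB_adj])
  have S_CSO: "S n \<in> CSO_b" for n
    unfolding S_def by (rule symmetrization(2)[OF AB AB_adj])
  have T_cadj: "cadjoint T = Ts"
    by (rule cadjoint_eqI) (fact T_adj)
  have "limitin SST S T sequentially"
    unfolding limitin_SST T_cadj S_adj
  proof (intro conjI allI T)
    show "\<forall>\<^sub>F n in sequentially. S n \<in> bounded_operators"
      using S_CSO by (simp add: CSO_b_def)
    show "(\<lambda>n. S n x) \<longlonglongrightarrow> T x" for x
      unfolding S_def A_def B_def
      by (rule symmetrized_truncation_tendsto[OF e f T Ts bounded_linear(1) _ off_diagonal1])
        (simp add: norm_C1)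
    show "(\<lambda>n. B n y + C2 n (A n (C2 n y))) \<longlonglongrightarrow> Ts y" for y
      unfolding A_def B_def
      by (rule symmetrized_truncation_tendsto[OF f e Ts T bounded_linear(2) norm_C2_le off_diagonal2])
  qed
  then show ?thesis
    using S_CSO by blast
qed

lemma limitin_in_closure_of:
  assumes "limitin X S l F" "F \<noteq> bot" "\<And>i. S i \<in> A"
  shows "l \<in> X closure_of A"
  unfolding in_closure_of
proof (intro conjI allI impI)
  show "l \<in> topspace X"
    using assms(1) by (rule limitin_topspace)
  fix U assume "l \<in> U \<and> openin X U"
  then have "\<forall>\<^sub>F i in F. S i \<in> U"
    using assms(1) by (simp add: limitin_def)
  then obtain i where "S i \<in> U"
    using assms(2) eventually_happens' by blast
  then show "\<exists>y. y \<in> A \<and> y \<in> U"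
    using assms(3) by blast
qed

theorem corollary4p4:
  assumes "separable_space (euclidean :: 'h::complex_hilbert topology)"
    and "infinite_dimensional TYPE('h)"
    and "separable_space (euclidean :: 'k::complex_hilbert topology)"
    and "infinite_dimensional TYPE('k)"
  shows "SST closure_of (CSO_b :: ('h \<Rightarrow> 'k) set) = bounded_operators
    \<and> SOT closure_of (CSO_b :: ('h \<Rightarrow> 'k) set) = bounded_operators
    \<and> WOT closure_of (CSO_b :: ('h \<Rightarrow> 'k) set) = bounded_operators"
proof -
  obtain e :: "nat \<Rightarrow> 'h" where e: "orthonormal_basis e"
    using orthonormal_basis_exists[OF assms(1,2)] ..
  obtain f :: "nat \<Rightarrow> 'k" where f: "orthonormal_basis f"
    using orthonormal_basis_exists[OF assms(3,4)] ..
  have "T \<in> SST closure_of CSO_b \<and> T \<in> SOT closure_of CSO_b \<and> T \<in> WOT closure_of CSO_b"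
    if T: "T \<in> bounded_operators" for T :: "'h \<Rightarrow> 'k"
  proof -
    obtain S :: "nat \<Rightarrow> 'h \<Rightarrow> 'k" where S: "\<And>n. S n \<in> CSO_b" and SST: "limitin SST S T sequentially"
      using CSO_b_sequence[OF e f T] by auto
    have SOT: "limitin SOT S T sequentially"
      using SST by (simp add: limitin_SST limitin_SOT)
    then have "limitin WOT S T sequentially"
      by (simp add: limitin_SOT limitin_WOT cinner.tendsto)
    then show ?thesis
      using SST SOT S by (intro conjI limitin_in_closure_of[of _ S T sequentially]) auto
  qed
  moreover have "topspace SST = (bounded_operators :: ('h \<Rightarrow> 'k) set)"
    "topspace SOT = (bounded_operators :: ('h \<Rightarrow> 'k) set)"
    "topspace WOT = (bounded_operators :: ('h \<Rightarrow> 'k) set)"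
    by (simp_all add: SST_def SOT_def WOT_def topspace_pullback_topology)
  ultimately show ?thesis
    using closure_of_subset_topspace[of SST "CSO_b :: ('h \<Rightarrow> 'k) set"]
      closure_of_subset_topspace[of SOT "CSO_b :: ('h \<Rightarrow> 'k) set"]
      closure_of_subset_topspace[of WOT "CSO_b :: ('h \<Rightarrow> 'k) set"]
    by (auto simp only: intro!: equalityI subsetI)
qed

end
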